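(* Let $K\ge1$ and $k=\frac{K-1}{K+1}\in[0,1)$. Suppose that $f(z)=h(z)+\overline{g(z)}=\sum_{n=0}^{\infty}a_nz^n+\overline{\sum_{n=1}^{\infty}b_nz^n}$ is a $K$-quasiconformal sense-preserving harmonic mapping in $\mathbb{D}$, where $h$ satisfies $\operatorname{Re} h(z)\le 1$ in $\mathbb{D}$ and $h(0)>0$. Then $$|h(z)|+\sum_{n=1}^{\infty}(|a_n|+|b_n|)r^n\le 1\quad\text{for } |z|=r\le \frac{K+1}{7K+3}.$$ The constant $(K+1)/(7K+3)$ is sharp.
   Context: $\mathbb{D}=\{z\in\mathbb{C}:|z|<1\}$. A harmonic mapping $f=h+\overline{g}$ in $\mathbb{D}$ ($h,g$ analytic, $g(0)=0$) is sense-preserving if $J_f=|h'|^2-|g'|^2>0$ in $\mathbb{D}$, equivalently $h'\neq0$ and the dilatation $\omega_f=g'/h'$ satisfies $|\omega_f|<1$ in $\mathbb{D}$. A sense-preserving homeomorphism $f$ of $\mathbb{D}$ onto a domain, in the Sobolev class $W^{1,2}_{loc}(\mathbb{D})$, is $K$-quasiconformal if $\frac{|f_z|+|f_{\bar z}|}{|f_z|-|f_{\bar z}|}\le K$ in $\mathbb{D}$; for $f=h+\overline g$ this means $|\omega_f(z)|\le k=\frac{K-1}{K+1}$, i.e. $|g'(z)|\le k|h'(z)|$ in $\mathbb{D}$. "Sharp" means that, for the given $K$, the constant cannot be replaced by any larger number: for every larger radius the inequality fails for some mapping $f$ satisfying the hypotheses and some $z$. *)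

theory Defs
  imports "HOL-Complex_Analysis.Complex_Analysis"
begin

definition wirtinger_z :: "(complex \<Rightarrow> complex) \<Rightarrow> complex \<Rightarrow> complex" where
  "wirtinger_z f z =
     (frechet_derivative f (at z) 1 - \<i> * frechet_derivative f (at z) \<i>) / 2"

definition wirtinger_zbar :: "(complex \<Rightarrow> complex) \<Rightarrow> complex \<Rightarrow> complex" where
  "wirtinger_zbar f z =
     (frechet_derivative f (at z) 1 + \<i> * frechet_derivative f (at z) \<i>) / 2"

(* For f = h + cnj g with h, g holomorphic, this is |h'|^2 - |g'|^2. *)
definition jacobian :: "(complex \<Rightarrow> complex) \<Rightarrow> complex \<Rightarrow> real" where
  "jacobian f z = (norm (wirtinger_z f z))\<^sup>2 - (norm (wirtinger_zbar f z))\<^sup>2"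

(* The analytic form of the notion, meant for functions that are real
   differentiable on U, such as harmonic mappings. *)
definition sense_preserving_on :: "(complex \<Rightarrow> complex) \<Rightarrow> complex set \<Rightarrow> bool" where
  "sense_preserving_on f U \<longleftrightarrow> (\<forall>z\<in>U. jacobian f z > 0)"

definition L2_loc :: "complex set \<Rightarrow> (complex \<Rightarrow> complex) \<Rightarrow> bool" where
  "L2_loc U f \<longleftrightarrow> f \<in> borel_measurable (lebesgue_on U) \<and>
     (\<forall>C. compact C \<and> C \<subseteq> U \<longrightarrow> set_integrable lebesgue C (\<lambda>z. (norm (f z))\<^sup>2))"

(* Compactly supported C^1 functions; testing first-order weak derivatives
   against these or against smooth functions gives the same notion. *)
definition test_fun :: "complex set \<Rightarrow> (complex \<Rightarrow> real) \<Rightarrow> bool" where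
  "test_fun U \<phi> \<longleftrightarrow>
     (\<forall>z. \<phi> differentiable (at z)) \<and>
     (\<forall>e. continuous_on UNIV (\<lambda>z. frechet_derivative \<phi> (at z) e)) \<and>
     (\<exists>C. compact C \<and> C \<subseteq> U \<and> (\<forall>z. z \<notin> C \<longrightarrow> \<phi> z = 0))"

(* v is the weak derivative of f on U in the direction e. *)
definition weak_partial ::
    "complex set \<Rightarrow> complex \<Rightarrow> (complex \<Rightarrow> complex) \<Rightarrow> (complex \<Rightarrow> complex) \<Rightarrow> bool" where
  "weak_partial U e f v \<longleftrightarrow>
     (\<forall>\<phi>. test_fun U \<phi> \<longrightarrow>
        set_lebesgue_integral lebesgue U (\<lambda>z. frechet_derivative \<phi> (at z) e *\<^sub>R f z) =
        - set_lebesgue_integral lebesgue U (\<lambda>z. \<phi> z *\<^sub>R v z))"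

definition W12_loc :: "complex set \<Rightarrow> (complex \<Rightarrow> complex) \<Rightarrow> bool" where
  "W12_loc U f \<longleftrightarrow> L2_loc U f \<and>
     (\<exists>p q. L2_loc U p \<and> L2_loc U q \<and> weak_partial U 1 f p \<and> weak_partial U \<i> f q)"

(* As sense_preserving_on, stated for functions that are real differentiable on U:
   the distortion inequality is required at every point. Its denominator is positive
   because f is sense-preserving. *)
definition quasiconformal_on ::
    "real \<Rightarrow> (complex \<Rightarrow> complex) \<Rightarrow> complex set \<Rightarrow> bool" where
  "quasiconformal_on K f U \<longleftrightarrow>
     (\<exists>V f'. open V \<and> connected V \<and> homeomorphism U V f f') \<and>
     sense_preserving_on f U \<and>
     W12_loc U f \<and>
     (\<forall>z\<in>U. (norm (wirtinger_z f z) + norm (wirtinger_zbar f z)) /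
             (norm (wirtinger_z f z) - norm (wirtinger_zbar f z)) \<le> K)"

(* The value b 0 plays no role: the expansion of g starts at n = 1, so g 0 = 0. *)
definition admissible ::
    "real \<Rightarrow> (complex \<Rightarrow> complex) \<Rightarrow> (complex \<Rightarrow> complex) \<Rightarrow>
     (nat \<Rightarrow> complex) \<Rightarrow> (nat \<Rightarrow> complex) \<Rightarrow> bool" where
  "admissible K h g a b \<longleftrightarrow>
     h holomorphic_on ball 0 1 \<and> g holomorphic_on ball 0 1 \<and>
     (\<forall>z\<in>ball 0 1. (\<lambda>n. a n * z ^ n) sums h z) \<and>
     (\<forall>z\<in>ball 0 1. (\<lambda>n. b (Suc n) * z ^ Suc n) sums g z) \<and>
     quasiconformal_on K (\<lambda>z. h z + cnj (g z)) (ball 0 1) \<and>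
     (\<forall>z\<in>ball 0 1. Re (h z) \<le> 1) \<and>
     h 0 \<in> \<real> \<and> 0 < Re (h 0)"

end

(* With k = (K - 1) / (K + 1), a power series with real part at most 1 satisfies
   |a n| <= 2 (1 - Re (a 0)) for n >= 1, by the Schwarz lemma. Quasiconformality gives
   |g'| <= k |h'|, so the dilatation g' / h' is bounded by k and, by Bohr's inequality, its majorant
   series is at most k on [0, 1/3]. Hence the majorant of g is at most k times that of h - h 0, and the
   left-hand side is at most a 0 + (2 + k) 2 (1 - a 0) r / (1 - r), which is at most 1 exactly when
   r <= 1 / (5 + 2 k). For sharpness let h map the disk conformally onto the half plane Re w < 1, with
   h 0 tending to 0, and let g be k (h - h 0). *)
theory Submission
  imports Defs
begin

section \<open>Coefficients of functions with bounded real part\<close>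

text \<open>The factor 2 + k counts copies of the majorant A of h - h 0: one from |h z| <= h 0 + A,
  one from the sum of the |a n|, and k from the sum of the |b n|. The bound on A carries the factor
  1 - h 0, which is also the room left below 1, so the radius does not depend on h 0. The number 1 /
  (5 + 2 k) equals (K + 1) / (7 K + 3); it is at most 1/5 and so lies in the range of Bohr's
  inequality. The majorants of g and h cannot be compared coefficient by coefficient, since |b n| <=
  k |a n| may fail. They are compared for g' and h' at every point of [0, 1/3], and the result is
  integrated. For sharpness the obstacle is membership in the class: quasiconformality includes a
  local Sobolev condition, so the classical derivatives of the extremal mapping must be shown to be
  weak ones.\<close>

lemma powser_coeffs_unique:
  fixes a b :: "nat \<Rightarrow> complex"
  assumes "0 < r"
    and "\<And>z. norm z < r \<Longrightarrow> (\<lambda>n. a n * z ^ n) sums f z"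
    and "\<And>z. norm z < r \<Longrightarrow> (\<lambda>n. b n * z ^ n) sums f z"
  shows "a = b"
proof (rule ccontr)
  assume "a \<noteq> b"
  then obtain m where m: "a m - b m \<noteq> 0"
    by auto
  have s: "(\<lambda>n. (a n - b n) * (z - 0) ^ n) sums 0" if "norm (z - 0) < r" for z
    using sums_diff[OF assms(2) assms(3), of z z] that by (simp add: algebra_simps)
  have "a 0 - b 0 = 0"
    using s[of 0] \<open>0 < r\<close> by simp
  with m have "m > 0"
    by (cases m) auto
  \<comment> \<open>A nonzero coefficient of positive index would make the sum, here the constant 0,
    nonzero on a punctured disk.\<close>
  show False
  proof (rule powser_0_nonzero[where f = "\<lambda>_. 0" and \<xi> = 0, OF \<open>0 < r\<close> s _ m \<open>m > 0\<close>])
    fix t :: real assume "0 < t" and nz: "\<And>z::complex. z \<in> cball 0 t - {0} \<Longrightarrow> (0::complex) \<noteq> 0"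
    show False
      using nz[of "of_real t"] \<open>0 < t\<close> by simp
  qed auto
qed

lemma powser_holomorphic_on_unit_ball:
  assumes "\<And>z. norm z < 1 \<Longrightarrow> (\<lambda>n. a n * z ^ n) sums f z"
  shows "f holomorphic_on ball 0 1"
  by (rule power_series_holomorphic[where a = a]) (use assms in auto)

lemma powser_deriv:
  fixes a :: "nat \<Rightarrow> complex"
  assumes sums: "\<And>z. norm z < 1 \<Longrightarrow> (\<lambda>n. a n * z ^ n) sums f z" and "norm z < 1"
  shows "(\<lambda>n. diffs a n * z ^ n) sums deriv f z"
proof (rule termdiffs_sums_strong[OF sums])
  show "(f has_field_derivative deriv f z) (at z)"
    using powser_holomorphic_on_unit_ball[OF sums] assms(2)
    by (intro holomorphic_derivI[of _ "ball 0 1"]) auto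
qed (use assms in auto)

text \<open>The Moebius map q / (2 m - q) carries the half plane Re q < m to the unit disk, fixes 0
  and has derivative 1 / (2 m) there. The Schwarz lemma, applied to its composition with f - a 0,
  therefore bounds |a 1| by 2 m.\<close>

lemma norm_first_coeff_le:
  assumes sums: "\<And>z. norm z < 1 \<Longrightarrow> (\<lambda>n. a n * z ^ n) sums f z"
    and Re_le: "\<And>z. norm z < 1 \<Longrightarrow> Re (f z) \<le> M"
  shows "norm (a 1) \<le> 2 * (M - Re (a 0))"
proof (rule field_le_epsilon)
  fix e :: real assume "e > 0"
  \<comment> \<open>The slack \<open>e / 2\<close> makes the half-plane bound strict and
    \<open>m\<close> positive even when f is constant with real part M.\<close>
  define m where "m = M + e / 2 - Re (a 0)"
  define \<psi> where "\<psi> z = (f z - a 0) / (2 * of_real m - (f z - a 0))" for z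
  have f0: "f 0 = a 0"
    using sums[of 0] by simp
  have "m > 0"
    using Re_le[of 0] f0 \<open>e > 0\<close> by (simp add: m_def)
  have lt: "norm (f z - a 0) < norm (2 * of_real m - (f z - a 0))" if "norm z < 1" for z
  proof -
    define q where "q = f z - a 0"
    \<comment> \<open>The difference of |2 m - q|^2 and |q|^2 is 4 m (m - Re q).\<close>
    have "m * Re q < m * m"
      using Re_le[OF that] \<open>m > 0\<close> \<open>e > 0\<close> by (simp add: q_def m_def)
    then have "(norm q)\<^sup>2 < (norm (2 * of_real m - q))\<^sup>2"
      unfolding cmod_power2 by (simp add: power2_eq_square algebra_simps)
    then show ?thesis
      unfolding q_def by (rule power2_less_imp_less) simp
  qed
  then have nz: "2 * of_real m - (f z - a 0) \<noteq> 0" if "norm z < 1" for z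
    using that by (metis norm_zero norm_not_less_zero)
  have hol: "f holomorphic_on ball 0 1"
    by (rule powser_holomorphic_on_unit_ball[OF sums])
  have "norm (deriv \<psi> 0) \<le> 1"
  proof (rule Schwarz_Lemma(2)[where \<xi> = 0])
    show "\<psi> holomorphic_on ball 0 1"
      unfolding \<psi>_def using nz by (intro holomorphic_intros hol) auto
    show "norm (\<psi> z) < 1" if "norm z < 1" for z
      using lt[OF that] nz[OF that] by (simp add: \<psi>_def norm_divide)
  qed (auto simp: \<psi>_def f0)
  moreover have "deriv \<psi> 0 = a 1 / (2 * of_real m)"
  proof (rule DERIV_imp_deriv)
    have "deriv f 0 = a 1"
      using powser_deriv[OF sums, of 0] by (simp add: diffs_def)
    then have [derivative_intros]: "(f has_field_derivative a 1) (at 0)"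
      using holomorphic_derivI[OF hol, of 0] by simp
    show "(\<psi> has_field_derivative a 1 / (2 * of_real m)) (at 0)"
      unfolding \<psi>_def using \<open>m > 0\<close>
      by (auto intro!: derivative_eq_intros simp: f0 field_simps)
  qed
  ultimately have "norm (a 1) \<le> 2 * m"
    using \<open>m > 0\<close> by (simp add: norm_divide field_simps)
  then show "norm (a 1) \<le> 2 * (M - Re (a 0)) + e"
    by (simp add: m_def algebra_simps)
qed

text \<open>The m-th power of the j-th root is the j-th power of exp (2 pi i m / n), so the sum is
  geometric with a ratio that is an n-th root of unity and equals 1 exactly when n divides
  m.\<close>

lemma sum_roots_of_unity_powers:
  assumes "n > 0"
  shows "(\<Sum>j<n. exp (2 * of_real pi * \<i> * of_nat j / of_nat n) ^ m) =
           (if n dvd m then of_nat n else 0 :: complex)"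
proof -
  define w where "w = exp (2 * of_real pi * \<i> * of_nat m / of_nat n)"
  have "exp (2 * of_real pi * \<i> * of_nat j / of_nat n) ^ m = w ^ j" for j
    by (simp add: w_def exp_of_nat_mult[symmetric] algebra_simps)
  moreover have "w = 1 \<longleftrightarrow> n dvd m"
    unfolding w_def using assms by (intro complex_root_unity_eq_1) auto
  moreover have "w ^ n = 1"
    unfolding w_def using assms by (intro complex_root_unity) auto
  ultimately show ?thesis
    using geometric_sum[of w n] by auto
qed

text \<open>The case of the first coefficient carries over to the \<open>n\<close>-th one because the average of
  \<open>f (\<zeta> z)\<close> over the \<open>n\<close>-th roots of unity \<open>\<zeta>\<close> is \<open>F (z\<^sup>n)\<close> with \<open>F w = (\<Sum>j. a (n j) w\<^sup>j)\<close>.\<close>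

lemma norm_coeff_le:
  assumes sums: "\<And>z. norm z < 1 \<Longrightarrow> (\<lambda>n. a n * z ^ n) sums f z"
    and Re_le: "\<And>z. norm z < 1 \<Longrightarrow> Re (f z) \<le> M"
    and "n > 0"
  shows "norm (a n) \<le> 2 * (M - Re (a 0))"
proof -
  define \<zeta> where "\<zeta> j = exp (2 * of_real pi * \<i> * of_nat j / of_nat n)" for j
  have norm_\<zeta>: "norm (\<zeta> j) = 1" for j
    by (simp add: \<zeta>_def)
  define F where "F w = (\<Sum>j. a (n * j) * w ^ j)" for w
  have F: "(\<lambda>j. a (n * j) * (z ^ n) ^ j) sums ((\<Sum>j<n. f (\<zeta> j * z)) / of_nat n)"
    if z: "norm z < 1" for z
  proof -
    have "(\<lambda>m. \<Sum>j<n. a m * (\<zeta> j * z) ^ m) sums (\<Sum>j<n. f (\<zeta> j * z))"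
      by (intro sums_sum sums) (simp add: norm_mult norm_\<zeta> z)
    moreover have "(\<Sum>j<n. a m * (\<zeta> j * z) ^ m) / of_nat n = (if n dvd m then a m * z ^ m else 0)" for m
    proof -
      have "(\<Sum>j<n. a m * (\<zeta> j * z) ^ m) = a m * z ^ m * (\<Sum>j<n. \<zeta> j ^ m)"
        by (simp add: sum_distrib_left power_mult_distrib algebra_simps)
      then show ?thesis
        unfolding \<zeta>_def sum_roots_of_unity_powers[OF \<open>n > 0\<close>] using \<open>n > 0\<close> by simp
    qed
    ultimately have *: "(\<lambda>m. if n dvd m then a m * z ^ m else 0) sums ((\<Sum>j<n. f (\<zeta> j * z)) / of_nat n)"
      using sums_divide[of _ _ "of_nat n :: complex"] by fastforce
    have "strict_mono (\<lambda>j. n * j)"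
      using \<open>n > 0\<close> by (auto simp: strict_mono_def)
    have "(\<lambda>j. if n dvd n * j then a (n * j) * z ^ (n * j) else 0) sums
        ((\<Sum>j<n. f (\<zeta> j * z)) / of_nat n)"
      by (rule sums_mono_reindex[THEN iffD2, OF \<open>strict_mono (\<lambda>j. n * j)\<close> _ *]) (auto simp: dvd_def)
    then show ?thesis
      by (simp add: power_mult)
  qed
  \<comment> \<open>The averages describe \<open>F\<close> only at n-th powers of points of the
    disk; by the existence of roots these fill the whole disk.\<close>
  have root: "\<exists>z. norm z < 1 \<and> w = z ^ n" if "norm w < 1" for w :: complex
  proof -
    obtain z where "w = z ^ n"
      using exists_complex_root[of n w] \<open>n > 0\<close> by auto
    with that show ?thesis
      by (metis norm_power not_less one_le_power)
  qed
  have "norm (a (n * 1)) \<le> 2 * (M - Re (a (n * 0)))"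
  proof (rule norm_first_coeff_le[where a = "\<lambda>j. a (n * j)" and f = F])
    fix w :: complex assume "norm w < 1"
    then obtain z where z: "norm z < 1" "w = z ^ n"
      using root by blast
    from F[OF z(1)] show "(\<lambda>j. a (n * j) * w ^ j) sums F w"
      by (simp add: F_def z(2) sums_iff)
    have "Re (F w) = (\<Sum>j<n. Re (f (\<zeta> j * z))) / n"
      using F[OF z(1)] by (simp add: F_def z(2) sums_iff)
    also have "\<dots> \<le> (\<Sum>j<n. M) / n"
      by (intro divide_right_mono sum_mono Re_le) (simp_all add: norm_mult norm_\<zeta> z)
    finally show "Re (F w) \<le> M"
      using \<open>n > 0\<close> by simp
  qed
  then show ?thesis
    by simp
qed

section \<open>Majorant series\<close>

text \<open>The sum vanishes at 0 and is nondecreasing up to r. This is the integration that carries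
  a comparison of the majorants of two derivatives over to the functions themselves.\<close>

lemma powser_nonneg_of_deriv_nonneg:
  fixes c :: "nat \<Rightarrow> real"
  assumes summ: "\<And>x. norm x < 1 \<Longrightarrow> summable (\<lambda>n. c n * x ^ n)" and "R < 1"
    and nonneg: "\<And>x. 0 \<le> x \<Longrightarrow> x \<le> R \<Longrightarrow> 0 \<le> (\<Sum>n. diffs c n * x ^ n)"
    and "c 0 = 0" "0 \<le> r" "r \<le> R"
  shows "0 \<le> (\<Sum>n. c n * r ^ n)"
proof -
  have "(\<Sum>n. c n * 0 ^ n) \<le> (\<Sum>n. c n * r ^ n)"
  proof (rule DERIV_nonneg_imp_nondecreasing[OF \<open>0 \<le> r\<close>])
    fix x assume x: "0 \<le> x" "x \<le> r"
    have "((\<lambda>x. \<Sum>n. c n * x ^ n) has_real_derivative (\<Sum>n. diffs c n * x ^ n)) (at x)"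
      by (rule termdiffs_strong'[where K = 1, OF summ]) (use x assms in auto)
    moreover have "0 \<le> (\<Sum>n. diffs c n * x ^ n)"
      using x assms by (intro nonneg) auto
    ultimately show "\<exists>y. ((\<lambda>x. \<Sum>n. c n * x ^ n) has_real_derivative y) (at x) \<and> 0 \<le> y"
      by blast
  qed
  then show ?thesis
    by (simp only: powser_zero \<open>c 0 = 0\<close>)
qed

lemma powser_norm_summable:
  fixes a :: "nat \<Rightarrow> complex"
  assumes "\<And>z. norm z < 1 \<Longrightarrow> (\<lambda>n. a n * z ^ n) sums f z" and "norm (x::real) < 1"
  shows "summable (\<lambda>n. norm (a n) * x ^ n)"
proof -
  \<comment> \<open>Convergence at a point of larger modulus yields absolute convergence at
    \<open>x\<close>.\<close>
  obtain y where y: "\<bar>x\<bar> < y" "y < 1"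
    using dense assms(2) by auto
  have "summable (\<lambda>n. norm (a n * of_real x ^ n))"
    by (rule powser_insidea[where x = "of_real y"])
      (use assms(1)[of "of_real y"] y in \<open>auto simp: sums_iff\<close>)
  then have "summable (\<lambda>n. norm (norm (a n) * x ^ n))"
    by (simp add: norm_mult norm_power abs_mult power_abs)
  then show ?thesis
    by (rule summable_norm_cancel)
qed

lemma suminf_eq_head_add_tail:
  fixes f :: "nat \<Rightarrow> real"
  assumes "summable f"
  shows "suminf f = f 0 + (\<Sum>n. f (Suc n))"
  using suminf_split_head[OF assms] by simp

lemma powser_convolution:
  fixes x :: "'a::comm_semiring_1"
  shows "(\<Sum>i\<le>n. (u i * x ^ i) * (v (n - i) * x ^ (n - i))) = (\<Sum>i\<le>n. u i * v (n - i)) * x ^ n"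
  unfolding sum_distrib_right
proof (intro sum.cong refl)
  fix i assume "i \<in> {..n}"
  then have "x ^ n = x ^ i * x ^ (n - i)"
    by (simp flip: power_add)
  then show "(u i * x ^ i) * (v (n - i) * x ^ (n - i)) = u i * v (n - i) * x ^ n"
    by (simp add: mult_ac)
qed

text \<open>After a rotation that makes \<open>w 0\<close> nonnegative, the half-plane coefficient
  bound is 2 (k - |w 0|). The radius 1/3 is where r / (1 - r) reaches 1/2, so the tail is at most k
  - |w 0|.\<close>

lemma bohr_inequality:
  fixes w :: "nat \<Rightarrow> complex"
  assumes sums: "\<And>z. norm z < 1 \<Longrightarrow> (\<lambda>n. w n * z ^ n) sums f z"
    and bound: "\<And>z. norm z < 1 \<Longrightarrow> norm (f z) \<le> k"
    and r: "0 \<le> r" "r \<le> 1 / 3"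
  shows "(\<Sum>n. norm (w n) * r ^ n) \<le> k"
proof -
  define u where "u = cis (- Arg (w 0))"
  have u: "norm u = 1"
    by (simp add: u_def)
  have "u * w 0 = u * rcis (norm (w 0)) (Arg (w 0))"
    by (simp add: rcis_cmod_Arg)
  then have uw0: "Re (u * w 0) = norm (w 0)"
    by (simp add: u_def rcis_def cis_mult mult.left_commute)
  have w0: "norm (w 0) \<le> k"
    using sums[of 0] bound[of 0] by simp
  have coeff: "norm (w n) \<le> 2 * (k - norm (w 0))" if "n > 0" for n
  proof -
    have "norm (u * w n) \<le> 2 * (k - Re (u * w 0))"
    proof (rule norm_coeff_le[where a = "\<lambda>n. u * w n" and f = "\<lambda>z. u * f z"])
      show "(\<lambda>n. u * w n * z ^ n) sums (u * f z)" if "norm z < 1" for z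
        using sums_mult[OF sums[OF that], of u] by (simp add: mult.assoc)
      show "Re (u * f z) \<le> k" if "norm z < 1" for z
        using bound[OF that] complex_Re_le_cmod[of "u * f z"] by (simp add: norm_mult u)
    qed fact
    then show ?thesis
      by (simp add: uw0 norm_mult u del: Re_complex_of_real times_complex.sel)
  qed
  have geo: "(\<lambda>n. r ^ Suc n) sums (r / (1 - r))"
    using sums_mult[OF geometric_sums[of r], of r] r by simp
  have summ: "summable (\<lambda>n. norm (w n) * r ^ n)"
    using r by (intro powser_norm_summable[OF sums]) auto
  then have "(\<Sum>n. norm (w n) * r ^ n) = norm (w 0) + (\<Sum>n. norm (w (Suc n)) * r ^ Suc n)"
    by (subst suminf_eq_head_add_tail) auto
  also have "(\<Sum>n. norm (w (Suc n)) * r ^ Suc n) \<le> (\<Sum>n. 2 * (k - norm (w 0)) * r ^ Suc n)"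
    using r geo by (intro suminf_le mult_right_mono coeff summable_mult)
      (use summ summable_Suc_iff[of "\<lambda>n. norm (w n) * r ^ n"] in \<open>auto simp: sums_iff\<close>)
  also have "\<dots> = 2 * (k - norm (w 0)) * (r / (1 - r))"
    using sums_mult[OF geo] by (simp only: sums_iff)
  also have "\<dots> \<le> 2 * (k - norm (w 0)) * (1 / 2)"
    using r w0 by (intro mult_left_mono) (auto simp: field_simps)
  finally show ?thesis
    by (simp add: diff_divide_distrib)
qed

text \<open>The majorant of a product is at most the product of the majorants. For g' = w h', Bohr's
  inequality bounds the factor coming from w by k at every point of [0, 1/3]; integration up to r
  gives the claim.\<close>

lemma majorant_le_of_norm_deriv_le:
  fixes a b :: "nat \<Rightarrow> complex"
  assumes h: "\<And>z. norm z < 1 \<Longrightarrow> (\<lambda>n. a n * z ^ n) sums h z"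
    and g: "\<And>z. norm z < 1 \<Longrightarrow> (\<lambda>n. b n * z ^ n) sums g z"
    and nz: "\<And>z. norm z < 1 \<Longrightarrow> deriv h z \<noteq> 0"
    and le: "\<And>z. norm z < 1 \<Longrightarrow> norm (deriv g z) \<le> k * norm (deriv h z)"
    and r: "0 \<le> r" "r \<le> 1 / 3"
  shows "(\<Sum>n. norm (b (Suc n)) * r ^ Suc n) \<le> k * (\<Sum>n. norm (a (Suc n)) * r ^ Suc n)"
proof -
  define w where "w z = deriv g z / deriv h z" for z
  define wc where "wc n = (deriv ^^ n) w 0 / fact n" for n
  have hol: "w holomorphic_on ball 0 1"
    unfolding w_def using nz
    by (intro holomorphic_intros holomorphic_deriv powser_holomorphic_on_unit_ball[OF h]
        powser_holomorphic_on_unit_ball[OF g]) auto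
  have w: "(\<lambda>n. wc n * z ^ n) sums w z" if "norm z < 1" for z
    using holomorphic_power_series[OF hol, of z] that by (simp add: wc_def)
  have w_le: "norm (w z) \<le> k" if "norm z < 1" for z
    using le[OF that] nz[OF that] by (simp add: w_def norm_divide field_simps)
  have summ_norm: "summable (\<lambda>n. norm (c n * z ^ n))"
    if "\<And>z. norm z < 1 \<Longrightarrow> (\<lambda>n. c n * z ^ n) sums f z" "norm z < 1" for c f and z :: complex
    using powser_norm_summable[OF that(1), of "norm z"] that(2) by (simp add: norm_mult norm_power)
  have diffs_b: "diffs b n = (\<Sum>i\<le>n. wc i * diffs a (n - i))" for n
  proof -
    \<comment> \<open>Both sequences are the coefficients of \<open>deriv g\<close>, the second one
      through the Cauchy product of the series of \<open>w\<close> and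
      \<open>deriv h\<close>.\<close>
    have "diffs b = (\<lambda>n. \<Sum>i\<le>n. wc i * diffs a (n - i))"
    proof (rule powser_coeffs_unique[of 1 _ "deriv g"])
      fix z :: complex assume z: "norm z < 1"
      show "(\<lambda>n. diffs b n * z ^ n) sums deriv g z"
        by (rule powser_deriv[OF g z])
      have "(\<lambda>n. \<Sum>i\<le>n. (wc i * z ^ i) * (diffs a (n - i) * z ^ (n - i))) sums
          ((\<Sum>n. wc n * z ^ n) * (\<Sum>n. diffs a n * z ^ n))"
        by (intro Cauchy_product_sums summ_norm[OF w z] summ_norm[OF powser_deriv[OF h] z])
      also have "(\<Sum>n. wc n * z ^ n) * (\<Sum>n. diffs a n * z ^ n) = deriv g z"
        using w[OF z] powser_deriv[OF h z] nz[OF z] by (simp add: sums_iff w_def)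
      also have "(\<lambda>n. \<Sum>i\<le>n. (wc i * z ^ i) * (diffs a (n - i) * z ^ (n - i))) =
          (\<lambda>n. (\<Sum>i\<le>n. wc i * diffs a (n - i)) * z ^ n)"
        by (simp only: powser_convolution)
      finally show "(\<lambda>n. (\<Sum>i\<le>n. wc i * diffs a (n - i)) * z ^ n) sums deriv g z" .
    qed simp
    then show ?thesis
      by meson
  qed
  have deriv_le: "(\<Sum>n. norm (diffs b n) * x ^ n) \<le> k * (\<Sum>n. norm (diffs a n) * x ^ n)"
    if x: "0 \<le> x" "x \<le> 1 / 3" for x
  proof -
    have summ_wc: "summable (\<lambda>n. norm (wc n) * x ^ n)"
      and summ_a: "summable (\<lambda>n. norm (diffs a n) * x ^ n)"
      and summ_b: "summable (\<lambda>n. norm (diffs b n) * x ^ n)"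
      using powser_norm_summable[OF w, of x] powser_norm_summable[OF powser_deriv[OF h], of x]
        powser_norm_summable[OF powser_deriv[OF g], of x] x by auto
    have "(\<lambda>n. \<Sum>i\<le>n. (norm (wc i) * x ^ i) * (norm (diffs a (n - i)) * x ^ (n - i))) sums
          ((\<Sum>n. norm (wc n) * x ^ n) * (\<Sum>n. norm (diffs a n) * x ^ n))"
      using x summ_wc summ_a by (intro Cauchy_product_sums) auto
    moreover have "norm (diffs b n) * x ^ n \<le>
        (\<Sum>i\<le>n. (norm (wc i) * x ^ i) * (norm (diffs a (n - i)) * x ^ (n - i)))" for n
    proof -
      have "norm (diffs b n) * x ^ n \<le> (\<Sum>i\<le>n. norm (wc i * diffs a (n - i))) * x ^ n"
        unfolding diffs_b using x by (intro mult_right_mono sum_norm_le) auto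
      also have "\<dots> = (\<Sum>i\<le>n. (norm (wc i) * x ^ i) * (norm (diffs a (n - i)) * x ^ (n - i)))"
        unfolding norm_mult
        by (rule powser_convolution[where v = "\<lambda>i. norm (diffs a i)", symmetric])
      finally show ?thesis .
    qed
    ultimately have "(\<Sum>n. norm (diffs b n) * x ^ n) \<le>
        (\<Sum>n. norm (wc n) * x ^ n) * (\<Sum>n. norm (diffs a n) * x ^ n)"
      by (intro sums_le[OF _ summable_sums[OF summ_b]])
    also have "\<dots> \<le> k * (\<Sum>n. norm (diffs a n) * x ^ n)"
      using x summ_a by (intro mult_right_mono bohr_inequality[OF w w_le] suminf_nonneg) auto
    finally show ?thesis .
  qed
  \<comment> \<open>These are the coefficients of k times the majorant of h - h 0 minus the majorant
    of g - g 0. The value 0 at n = 0 drops the constant terms, so the series vanishes where the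
    integration starts.\<close>
  define c where "c n = (if n = 0 then 0 else k * norm (a n) - norm (b n))" for n
  have summ_Suc: "summable (\<lambda>n. norm (a (Suc n)) * x ^ Suc n)" "summable (\<lambda>n. norm (b (Suc n)) * x ^ Suc n)"
    if "norm x < 1" for x :: real
    using powser_norm_summable[OF h that] powser_norm_summable[OF g that]
      summable_Suc_iff[of "\<lambda>n. norm (a n) * x ^ n"] summable_Suc_iff[of "\<lambda>n. norm (b n) * x ^ n"]
    by auto
  have c_sums: "(\<lambda>n. c (Suc n) * x ^ Suc n) sums
      (k * (\<Sum>n. norm (a (Suc n)) * x ^ Suc n) - (\<Sum>n. norm (b (Suc n)) * x ^ Suc n))"
    if "norm x < 1" for x :: real
  proof -
    have "(\<lambda>n. k * (norm (a (Suc n)) * x ^ Suc n) - norm (b (Suc n)) * x ^ Suc n) sums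
      (k * (\<Sum>n. norm (a (Suc n)) * x ^ Suc n) - (\<Sum>n. norm (b (Suc n)) * x ^ Suc n))"
      by (intro sums_diff sums_mult summable_sums summ_Suc that)
    then show ?thesis
      by (simp add: c_def algebra_simps)
  qed
  have c_summ: "summable (\<lambda>n. c n * x ^ n)" if "norm x < 1" for x
    using c_sums[OF that] summable_Suc_iff[of "\<lambda>n. c n * x ^ n"] by (auto simp: sums_iff)
  have "0 \<le> (\<Sum>n. c n * r ^ n)"
  proof (rule powser_nonneg_of_deriv_nonneg[OF c_summ _ _ _ r])
    fix x :: real assume x: "0 \<le> x" "x \<le> 1 / 3"
    have "diffs c n = k * norm (diffs a n) - norm (diffs b n)" for n
      by (simp add: diffs_def c_def norm_mult algebra_simps del: of_nat_Suc)
    then have "(\<Sum>n. diffs c n * x ^ n) =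
        (\<Sum>n. k * (norm (diffs a n) * x ^ n) - norm (diffs b n) * x ^ n)"
      by (simp add: left_diff_distrib mult.assoc)
    also have "\<dots> = k * (\<Sum>n. norm (diffs a n) * x ^ n) - (\<Sum>n. norm (diffs b n) * x ^ n)"
      using x powser_norm_summable[OF powser_deriv[OF h], of x]
        powser_norm_summable[OF powser_deriv[OF g], of x]
      by (subst suminf_diff[symmetric]) (auto simp: suminf_mult summable_mult)
    finally show "0 \<le> (\<Sum>n. diffs c n * x ^ n)"
      using deriv_le[OF x] by simp
  qed (auto simp: c_def)
  also have "(\<Sum>n. c n * r ^ n) =
      k * (\<Sum>n. norm (a (Suc n)) * r ^ Suc n) - (\<Sum>n. norm (b (Suc n)) * r ^ Suc n)"
    using c_sums[of r] suminf_eq_head_add_tail[OF c_summ[of r]] r by (simp add: sums_iff c_def)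
  finally show ?thesis
    by simp
qed

section \<open>The Bohr inequality for harmonic quasiconformal mappings\<close>

lemma has_derivative_add_cnj:
  assumes "(h has_field_derivative h') (at z)" and "(g has_field_derivative g') (at z)"
  shows "((\<lambda>z. h z + cnj (g z)) has_derivative (\<lambda>v. h' * v + cnj (g' * v))) (at z)"
  using assms unfolding has_field_derivative_def
  by (intro has_derivative_add has_derivative_cnj) auto

lemma wirtinger_add_cnj:
  assumes "(h has_field_derivative h') (at z)" and "(g has_field_derivative g') (at z)"
  shows "wirtinger_z (\<lambda>z. h z + cnj (g z)) z = h'"
    and "wirtinger_zbar (\<lambda>z. h z + cnj (g z)) z = cnj g'"
  unfolding wirtinger_z_def wirtinger_zbar_def
    frechet_derivative_at[OF has_derivative_add_cnj[OF assms], symmetric]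
  by (simp_all add: algebra_simps)

text \<open>The positive Jacobian gives |g'| < |h'|, so the denominator of the distortion quotient
  is positive and may be cleared; collecting terms produces the constant (K - 1) / (K + 1).\<close>

lemma norm_deriv_le_of_quasiconformal_on:
  assumes qc: "quasiconformal_on K (\<lambda>z. h z + cnj (g z)) U" and "z \<in> U" and "K \<ge> 1"
    and deriv: "(h has_field_derivative h') (at z)" "(g has_field_derivative g') (at z)"
  shows "h' \<noteq> 0" and "norm g' \<le> (K - 1) / (K + 1) * norm h'"
proof -
  have "(norm g')\<^sup>2 < (norm h')\<^sup>2"
    using qc \<open>z \<in> U\<close>
    by (auto simp: quasiconformal_on_def sense_preserving_on_def jacobian_def wirtinger_add_cnj[OF deriv])
  then have less: "norm g' < norm h'"
    by (rule power2_less_imp_less) simp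
  then show "h' \<noteq> 0"
    by auto
  have "(norm h' + norm g') / (norm h' - norm g') \<le> K"
    using qc \<open>z \<in> U\<close> by (auto simp: quasiconformal_on_def wirtinger_add_cnj[OF deriv])
  with less have "norm g' * (K + 1) \<le> (K - 1) * norm h'"
    by (simp add: field_simps)
  then show "norm g' \<le> (K - 1) / (K + 1) * norm h'"
    using \<open>K \<ge> 1\<close> by (simp add: field_simps)
qed

lemma bohr_sum_admissible:
  assumes adm: "admissible K h g a b" and "K \<ge> 1" and r: "norm z = r" "r \<le> (K + 1) / (7 * K + 3)"
  shows "summable (\<lambda>n. (norm (a (Suc n)) + norm (b (Suc n))) * r ^ Suc n)"
    and "norm (h z) + (\<Sum>n. (norm (a (Suc n)) + norm (b (Suc n))) * r ^ Suc n) \<le> 1"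
proof -
  define k where "k = (K - 1) / (K + 1)"
  define \<alpha> where "\<alpha> = Re (h 0)"
  have "0 \<le> k"
    using \<open>K \<ge> 1\<close> by (simp add: k_def)
  have "0 \<le> r"
    using r by auto
  have "(K + 1) / (7 * K + 3) \<le> 1 / 5"
    using \<open>K \<ge> 1\<close> by (simp add: field_simps)
  with r(2) have "r \<le> 1 / 5"
    by (rule order_trans)
  \<comment> \<open>Only here does the exact radius matter; the other estimates need just
    \<open>r \<le> 1 / 5\<close>, which keeps the series convergent and r below 1/3.\<close>
  have radius: "(2 + k) * (2 * (r / (1 - r))) \<le> 1"
  proof -
    have "r * (7 * K + 3) \<le> K + 1"
      using r \<open>K \<ge> 1\<close> by (simp add: field_simps)
    then have "(3 * K + 1) * (2 * r) \<le> (K + 1) * (1 - r)"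
      by (simp add: algebra_simps)
    moreover have "2 + k = (3 * K + 1) / (K + 1)"
      using \<open>K \<ge> 1\<close> by (simp add: k_def field_simps)
    moreover have "(3 * K + 1) / (K + 1) * (2 * (r / (1 - r))) = (3 * K + 1) * (2 * r) / ((K + 1) * (1 - r))"
      by simp
    ultimately show ?thesis
      using \<open>r \<le> 1 / 5\<close> \<open>K \<ge> 1\<close> by (simp add: divide_le_eq_1_pos del: times_divide_eq_right times_divide_eq_left)
  qed
  have hs: "(\<lambda>n. a n * z ^ n) sums h z" if "norm z < 1" for z
    using adm that by (auto simp: admissible_def)
  \<comment> \<open>The series of \<open>g\<close> starts at n = 1; the value 0 at n = 0 turns it
    into a full power series with the same sum.\<close>
  define b' where "b' n = (if n = 0 then 0 else b n)" for n
  have gs: "(\<lambda>n. b' n * z ^ n) sums g z" if "norm z < 1" for z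
  proof -
    have "(\<lambda>n. b' (Suc n) * z ^ Suc n) sums g z"
      using adm that by (auto simp: admissible_def b'_def)
    then show ?thesis
      by (subst (asm) sums_Suc_iff) (simp add: b'_def)
  qed
  have h_deriv: "(h has_field_derivative deriv h z) (at z)" if "norm z < 1" for z
    using adm that by (intro holomorphic_derivI[of _ "ball 0 1"]) (auto simp: admissible_def)
  have g_deriv: "(g has_field_derivative deriv g z) (at z)" if "norm z < 1" for z
    using adm that by (intro holomorphic_derivI[of _ "ball 0 1"]) (auto simp: admissible_def)
  have qc: "quasiconformal_on K (\<lambda>z. h z + cnj (g z)) (ball 0 1)"
    using adm by (simp add: admissible_def)
  have Re_le: "Re (h z) \<le> 1" if "norm z < 1" for z
    using adm that by (simp add: admissible_def)
  have a0: "a 0 = h 0"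
    using hs[of 0] by simp
  \<comment> \<open>The triangle inequality involves |a 0| and the coefficient bound Re (a 0); they
    agree because \<open>h 0\<close> is a positive real.\<close>
  have norm_a0: "norm (a 0) = \<alpha>" and Re_a0: "Re (a 0) = \<alpha>"
    using adm by (auto simp: admissible_def a0 \<alpha>_def elim!: Reals_cases)
  have "\<alpha> \<le> 1"
    using Re_le[of 0] by (simp add: \<alpha>_def)
  have summ_a: "summable (\<lambda>n. norm (a n) * r ^ n)"
    and summ_b: "summable (\<lambda>n. norm (b' n) * r ^ n)"
    using powser_norm_summable[OF hs, of r] powser_norm_summable[OF gs, of r] \<open>0 \<le> r\<close> \<open>r \<le> 1 / 5\<close>
    by auto
  define A where "A = (\<Sum>n. norm (a (Suc n)) * r ^ Suc n)"
  have A: "(\<lambda>n. norm (a (Suc n)) * r ^ Suc n) sums A"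
    using summ_a summable_Suc_iff[of "\<lambda>n. norm (a n) * r ^ n"] by (simp add: A_def summable_sums)
  define B where "B = (\<Sum>n. norm (b (Suc n)) * r ^ Suc n)"
  have B: "(\<lambda>n. norm (b (Suc n)) * r ^ Suc n) sums B"
    using summ_b summable_Suc_iff[of "\<lambda>n. norm (b' n) * r ^ n"]
    by (simp add: B_def b'_def summable_sums)
  have AB: "(\<lambda>n. (norm (a (Suc n)) + norm (b (Suc n))) * r ^ Suc n) sums (A + B)"
    using sums_add[OF A B] by (simp add: algebra_simps)
  then show "summable (\<lambda>n. (norm (a (Suc n)) + norm (b (Suc n))) * r ^ Suc n)"
    by (simp add: sums_iff)
  have "(\<Sum>n. norm (b' (Suc n)) * r ^ Suc n) \<le> k * A"
    unfolding A_def
  proof (rule majorant_le_of_norm_deriv_le[OF hs gs])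
    show "norm (deriv g z) \<le> k * norm (deriv h z)" "deriv h z \<noteq> 0" if "norm z < 1" for z
      using norm_deriv_le_of_quasiconformal_on[OF qc _ \<open>K \<ge> 1\<close> h_deriv[OF that] g_deriv[OF that]] that
      by (auto simp: k_def)
  qed (use \<open>0 \<le> r\<close> \<open>r \<le> 1 / 5\<close> in auto)
  then have B_le: "B \<le> k * A"
    by (simp add: B_def b'_def)
  have geo: "(\<lambda>n. 2 * (1 - \<alpha>) * r ^ Suc n) sums (2 * (1 - \<alpha>) * (r / (1 - r)))"
    using sums_mult[OF geometric_sums[of r], of "2 * (1 - \<alpha>) * r"] \<open>0 \<le> r\<close> \<open>r \<le> 1 / 5\<close>
    by (simp add: mult.assoc)
  have "A \<le> 2 * (1 - \<alpha>) * (r / (1 - r))"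
  proof (rule sums_le[OF _ A geo])
    show "norm (a (Suc n)) * r ^ Suc n \<le> 2 * (1 - \<alpha>) * r ^ Suc n" for n
      using norm_coeff_le[OF hs Re_le, of "Suc n"] \<open>0 \<le> r\<close>
      by (intro mult_right_mono) (auto simp: Re_a0)
  qed
  then have "(2 + k) * A \<le> (2 + k) * (2 * (1 - \<alpha>) * (r / (1 - r)))"
    using \<open>0 \<le> k\<close> by (intro mult_left_mono) auto
  also have "\<dots> = (1 - \<alpha>) * ((2 + k) * (2 * (r / (1 - r))))"
    by (simp only: mult_ac)
  also have "\<dots> \<le> 1 - \<alpha>"
    using mult_left_mono[OF radius, of "1 - \<alpha>"] \<open>\<alpha> \<le> 1\<close> by simp
  finally have A_le: "(2 + k) * A \<le> 1 - \<alpha>" .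
  have "norm (h z) \<le> (\<Sum>n. norm (a n * z ^ n))"
  proof -
    have "summable (\<lambda>n. norm (a n * z ^ n))"
      using summ_a by (simp add: norm_mult norm_power r)
    then show ?thesis
      using summable_norm hs[of z] r \<open>r \<le> 1 / 5\<close> by (fastforce simp: sums_iff)
  qed
  also have "\<dots> = \<alpha> + A"
    using suminf_eq_head_add_tail[OF summ_a] by (simp add: norm_mult norm_power r norm_a0 A_def)
  finally have "norm (h z) + (A + B) \<le> \<alpha> + (2 + k) * A"
    using B_le by (simp add: algebra_simps)
  then show "norm (h z) + (\<Sum>n. (norm (a (Suc n)) + norm (b (Suc n))) * r ^ Suc n) \<le> 1"
    using AB A_le by (simp add: sums_iff)
qed

section \<open>Weak derivatives of continuously differentiable functions\<close>

lemma lborel_integral_translate: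
  fixes F :: "'a::euclidean_space \<Rightarrow> 'b::{banach, second_countable_topology}"
  assumes "integrable lborel F"
  shows "integrable lborel (\<lambda>x. F (c + x))" and "integral\<^sup>L lborel (\<lambda>x. F (c + x)) = integral\<^sup>L lborel F"
proof -
  have *: "(\<lambda>x. c + x) \<in> measurable lborel borel" and F: "F \<in> borel_measurable borel"
    using assms by auto
  show "integrable lborel (\<lambda>x. F (c + x))"
    using integrable_distr[OF *, of F] assms by (simp add: lborel_distr_plus)
  show "integral\<^sup>L lborel (\<lambda>x. F (c + x)) = integral\<^sup>L lborel F"
    using integral_distr[OF * F] by (simp add: lborel_distr_plus)
qed

lemma integrable_lborel_compact_support:
  fixes F :: "'a::euclidean_space \<Rightarrow> 'b::{banach, second_countable_topology}"
  assumes "compact C" "continuous_on C F" "\<And>x. x \<notin> C \<Longrightarrow> F x = 0"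
  shows "integrable lborel F"
proof -
  have "(\<lambda>x. indicator C x *\<^sub>R F x) = F"
    using assms(3) by (auto simp: indicator_def)
  then show ?thesis
    using borel_integrable_compact[OF assms(1,2)] by simp
qed

text \<open>By translation invariance all difference quotients of a compactly supported function have
  integral \<open>0\<close>; they are bounded uniformly on a common compact support.\<close>

lemma integral_directional_derivative_eq_0:
  fixes F :: "'a::euclidean_space \<Rightarrow> 'b::euclidean_space"
  assumes deriv: "\<And>x. (F has_derivative F' x) (at x)"
    and cont: "continuous_on UNIV (\<lambda>x. F' x e)"
    and C: "compact C" "\<And>x. x \<notin> C \<Longrightarrow> F x = 0" "\<And>x. x \<notin> C \<Longrightarrow> F' x e = 0"
  shows "integral\<^sup>L lborel (\<lambda>x. F' x e) = 0"
proof -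
  define t where "t n = 1 / real (Suc n)" for n
  have t: "0 < t n" "t n \<le> 1" for n
    by (auto simp: t_def)
  define s where "s n x = (F (t n *\<^sub>R e + x) - F x) /\<^sub>R t n" for n x
  have contF: "continuous_on S F" for S
    using deriv by (meson continuous_at_imp_continuous_on has_derivative_continuous)
  have intF: "integrable lborel F"
    by (rule integrable_lborel_compact_support[OF C(1) contF C(2)])
  have int_s: "integral\<^sup>L lborel (s n) = 0" for n
    unfolding s_def using lborel_integral_translate[OF intF, of "t n *\<^sub>R e"] intF
    by (simp add: scaleR_right.minus integral_scaleR_right)
  have s_meas: "s n \<in> borel_measurable lborel" for n
  proof -
    have "continuous_on UNIV (s n)"
      unfolding s_def using t(1)[of n]
      by (intro continuous_intros continuous_on_compose2[OF contF[of UNIV]]) auto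
    then show ?thesis
      by (simp add: borel_measurable_continuous_onI)
  qed
  obtain B where B: "\<And>x. norm (F' x e) \<le> B"
  proof -
    have "compact ((\<lambda>x. F' x e) ` C)"
      using cont C(1) by (intro compact_continuous_image continuous_on_subset[OF cont]) auto
    then obtain B where "\<And>x. x \<in> C \<Longrightarrow> norm (F' x e) \<le> B"
      by (meson bounded_iff compact_imp_bounded imageI)
    then have "norm (F' x e) \<le> \<bar>B\<bar>" for x
      using C(3)[of x] by (cases "x \<in> C") (auto intro: order_trans[OF _ abs_ge_self])
    then show ?thesis
      using that by blast
  qed
  obtain M where M: "\<And>x. x \<in> C \<Longrightarrow> norm x \<le> M"
    using C(1) by (meson bounded_iff compact_imp_bounded)
  \<comment> \<open>All shifts \<open>t n *\<^sub>R e\<close> have norm at most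
    \<open>norm e\<close>, so one ball contains the supports of all difference quotients.\<close>
  define D where "D = cball (0::'a) (M + norm e)"
  have s_zero: "s n x = 0" if "x \<notin> D" for n x
  proof -
    have "norm (t n *\<^sub>R e) \<le> norm e"
      using t[of n] by (simp add: mult_left_le_one_le)
    moreover have "norm x \<le> norm (t n *\<^sub>R e + x) + norm (t n *\<^sub>R e)"
      by (metis add_diff_cancel_left' norm_triangle_sub add.commute norm_minus_commute norm_triangle_ineq4)
    ultimately have "x \<notin> C" "t n *\<^sub>R e + x \<notin> C"
      using that M[of x] M[of "t n *\<^sub>R e + x"] norm_ge_zero[of e] by (auto simp: D_def simp del: norm_scaleR)
    then show ?thesis
      by (simp add: s_def C)
  qed
  have line: "((\<lambda>u. F (u *\<^sub>R e + x)) has_derivative (\<lambda>u. u *\<^sub>R F' (v *\<^sub>R e + x) e)) (at v)" for x v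
  proof -
    have "((\<lambda>u. F (u *\<^sub>R e + x)) has_derivative (\<lambda>u. F' (v *\<^sub>R e + x) (u *\<^sub>R e))) (at v)"
      by (rule has_derivative_compose[OF _ deriv]) (auto intro!: derivative_eq_intros)
    then show ?thesis
      using has_derivative_bounded_linear[OF deriv] by (simp add: linear_simps bounded_linear.linear linear_scale)
  qed
  have s_le: "norm (s n x) \<le> B" for n x
  proof -
    \<comment> \<open>The mean value inequality on the segment bounds the quotients by
      \<open>B\<close>, so \<open>B\<close> on \<open>D\<close> is a dominating function.\<close>
    have "\<exists>u\<in>{0<..<t n}. norm (F (t n *\<^sub>R e + x) - F (0 *\<^sub>R e + x)) \<le> norm ((t n - 0) *\<^sub>R F' (u *\<^sub>R e + x) e)"
      using t(1)[of n] has_derivative_continuous[OF line]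
      by (intro mvt_general[of _ _ "\<lambda>u. F (u *\<^sub>R e + x)" "\<lambda>v u. u *\<^sub>R F' (v *\<^sub>R e + x) e"]
          continuous_at_imp_continuous_on line) auto
    then obtain u where "norm (F (t n *\<^sub>R e + x) - F x) \<le> t n * norm (F' (u *\<^sub>R e + x) e)"
      using t(1)[of n] by auto
    also have "\<dots> \<le> t n * B"
      using B t(1)[of n] by (intro mult_left_mono) auto
    finally show ?thesis
      using t(1)[of n] unfolding s_def norm_scaleR by (simp add: field_simps)
  qed
  have s_lim: "(\<lambda>n. s n x) \<longlonglongrightarrow> F' x e" for x
  proof -
    have "(\<lambda>h. norm (F (h *\<^sub>R e + x) - F x - h *\<^sub>R F' x e) / norm h) \<midarrow>0\<rightarrow> 0"
      using line[of x 0] by (simp add: has_derivative_at)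
    moreover have "filterlim t (at 0) sequentially"
      using t(1) LIMSEQ_inverse_real_of_nat
      by (auto simp: filterlim_at t_def[abs_def] inverse_eq_divide less_imp_neq[symmetric])
    ultimately have "(\<lambda>n. norm (F (t n *\<^sub>R e + x) - F x - t n *\<^sub>R F' x e) / norm (t n)) \<longlonglongrightarrow> 0"
      by (rule filterlim_compose)
    also have "(\<lambda>n. norm (F (t n *\<^sub>R e + x) - F x - t n *\<^sub>R F' x e) / norm (t n)) = (\<lambda>n. norm (s n x - F' x e))"
    proof
      fix n
      have "s n x - F' x e = (F (t n *\<^sub>R e + x) - F x - t n *\<^sub>R F' x e) /\<^sub>R t n"
        using t(1)[of n] by (simp add: s_def scaleR_right_diff_distrib)
      show "norm (F (t n *\<^sub>R e + x) - F x - t n *\<^sub>R F' x e) / norm (t n) = norm (s n x - F' x e)"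
        unfolding \<open>s n x - F' x e = _\<close> norm_scaleR by (simp add: divide_inverse mult.commute)
    qed
    finally show ?thesis
      by (rule LIM_zero_cancel[OF tendsto_norm_zero_cancel])
  qed
  have "(\<lambda>n. integral\<^sup>L lborel (s n)) \<longlonglongrightarrow> integral\<^sup>L lborel (\<lambda>x. F' x e)"
  proof (rule integral_dominated_convergence)
    show "integrable lborel (\<lambda>x. indicator D x *\<^sub>R B)"
      by (rule borel_integrable_compact) (auto simp: D_def)
    show "AE x in lborel. norm (s n x) \<le> indicator D x *\<^sub>R B" for n
      using s_le s_zero by (intro AE_I2) (auto simp: indicator_def)
  qed (use s_meas s_lim cont in \<open>auto intro!: borel_measurable_continuous_onI\<close>)
  then show ?thesis
    by (simp add: int_s LIMSEQ_const_iff)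
qed

text \<open>This links the set integrals over U in the definition of weak derivatives to integrals
  over the plane, where translation invariance is applied.\<close>

lemma set_integral_lebesgue_compact_support:
  fixes G :: "'a::euclidean_space \<Rightarrow> 'b::{banach, second_countable_topology}"
  assumes C: "compact C" "C \<subseteq> U" and cont: "continuous_on C G" and "\<And>x. x \<notin> C \<Longrightarrow> G x = 0"
  shows "set_lebesgue_integral lebesgue U G = integral\<^sup>L lborel G"
proof -
  have "(\<lambda>x. indicator U x *\<^sub>R G x) = G"
    using assms by (fastforce simp: indicator_def)
  moreover have "integrable lborel G"
    by (rule integrable_lborel_compact_support[OF C(1) cont assms(4)])
  ultimately show ?thesis
    by (simp add: set_lebesgue_integral_def integral_completion)
qed

text \<open>This is integration by parts: the product of \<phi> and f, being zero off the support of
  \<phi>, is differentiable on the whole plane, and its derivative in the direction e has integral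
  0.\<close>

lemma weak_partial_of_has_derivative:
  assumes "open U" and deriv: "\<And>z. z \<in> U \<Longrightarrow> (f has_derivative f' z) (at z)"
    and cont: "continuous_on U (\<lambda>z. f' z e)"
  shows "weak_partial U e f (\<lambda>z. f' z e)"
  unfolding weak_partial_def
proof (intro allI impI)
  fix \<phi> :: "complex \<Rightarrow> real" assume "test_fun U \<phi>"
  define \<phi>' where "\<phi>' z = frechet_derivative \<phi> (at z)" for z
  obtain C where \<phi>: "(\<phi> has_derivative \<phi>' z) (at z)" "continuous_on UNIV (\<lambda>z. \<phi>' z e)"
    and C: "compact C" "C \<subseteq> U" and \<phi>0: "z \<notin> C \<Longrightarrow> \<phi> z = 0" for z
    using \<open>test_fun U \<phi>\<close> unfolding test_fun_def \<phi>'_def frechet_derivative_works by blast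
  have "open (- C)"
    using C(1) by (simp add: compact_imp_closed open_Compl)
  \<comment> \<open>Since \<open>C\<close> is closed, \<phi> vanishes near every point outside
    it.\<close>
  have \<phi>'0: "\<phi>' z = (\<lambda>_. 0)" if "z \<notin> C" for z
  proof (rule has_derivative_unique[OF \<phi>(1)])
    show "(\<phi> has_derivative (\<lambda>_. 0)) (at z)"
      by (rule has_derivative_transform_within_open[OF has_derivative_const \<open>open (- C)\<close>])
        (use that in \<open>auto simp: \<phi>0\<close>)
  qed
  have contf: "continuous_on U f"
    using deriv by (meson continuous_at_imp_continuous_on has_derivative_continuous)
  have cont\<phi>: "continuous_on U \<phi>"
    using \<phi>(1) by (meson continuous_at_imp_continuous_on has_derivative_continuous)
  \<comment> \<open>Nothing is known about \<open>f'\<close> outside \<open>U\<close>, so the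
    product rule is used on \<open>U\<close> only; the two open sets \<open>U\<close> and
    \<open>- C\<close> cover the plane, and on their overlap both descriptions give 0.\<close>
  define F' where "F' z v = (if z \<in> U then \<phi> z *\<^sub>R f' z v + \<phi>' z v *\<^sub>R f z else 0)" for z v
  have F'0: "F' z v = 0" if "z \<notin> C" for z v
    using that by (simp add: F'_def \<phi>0 \<phi>'0)
  have cont1: "continuous_on U (\<lambda>z. \<phi>' z e *\<^sub>R f z)" and cont2: "continuous_on U (\<lambda>z. \<phi> z *\<^sub>R f' z e)"
    by (intro continuous_intros contf cont cont\<phi> continuous_on_subset[OF \<phi>(2)] subset_UNIV)+
  have "continuous_on (U \<union> - C) (\<lambda>z. F' z e)"
  proof (rule continuous_on_open_Un[OF \<open>open U\<close> \<open>open (- C)\<close>])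
    show "continuous_on U (\<lambda>z. F' z e)"
      using continuous_on_add[OF cont2 cont1] by (rule continuous_on_eq) (simp add: F'_def)
    show "continuous_on (- C) (\<lambda>z. F' z e)"
      by (rule continuous_on_eq[OF continuous_on_const[of _ 0]]) (simp add: F'0)
  qed
  moreover have "U \<union> - C = UNIV"
    using C by auto
  ultimately have contF': "continuous_on UNIV (\<lambda>z. F' z e)"
    by simp
  have derivF: "((\<lambda>z. \<phi> z *\<^sub>R f z) has_derivative F' z) (at z)" for z
  proof (cases "z \<in> U")
    case True
    then show ?thesis
      using has_derivative_scaleR[OF \<phi>(1) deriv[OF True]] by (simp add: F'_def[abs_def])
  next
    case False
    then have "z \<notin> C"
      using C by auto
    have "((\<lambda>z. \<phi> z *\<^sub>R f z) has_derivative (\<lambda>_. 0)) (at z)"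
      by (rule has_derivative_transform_within_open[OF has_derivative_const \<open>open (- C)\<close>])
        (use \<open>z \<notin> C\<close> in \<open>auto simp: \<phi>0\<close>)
    moreover have "F' z = (\<lambda>_. 0)"
      using F'0[OF \<open>z \<notin> C\<close>] by auto
    ultimately show ?thesis
      by simp
  qed
  have "integral\<^sup>L lborel (\<lambda>z. F' z e) = 0"
    by (rule integral_directional_derivative_eq_0[OF derivF contF' C(1)]) (simp_all add: \<phi>0 F'0)
  also have "(\<lambda>z. F' z e) = (\<lambda>z. \<phi> z *\<^sub>R f' z e + \<phi>' z e *\<^sub>R f z)"
  proof
    show "F' z e = \<phi> z *\<^sub>R f' z e + \<phi>' z e *\<^sub>R f z" for z
      using C(2) \<phi>0[of z] \<phi>'0[of z] by (cases "z \<in> C") (auto simp: F'_def)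
  qed
  also have "integral\<^sup>L lborel \<dots> =
      integral\<^sup>L lborel (\<lambda>z. \<phi> z *\<^sub>R f' z e) + integral\<^sup>L lborel (\<lambda>z. \<phi>' z e *\<^sub>R f z)"
    by (intro Bochner_Integration.integral_add integrable_lborel_compact_support[OF C(1)]
        continuous_on_subset[OF cont1 C(2)] continuous_on_subset[OF cont2 C(2)]) (simp_all add: \<phi>0 \<phi>'0)
  also have "integral\<^sup>L lborel (\<lambda>z. \<phi> z *\<^sub>R f' z e) = set_lebesgue_integral lebesgue U (\<lambda>z. \<phi> z *\<^sub>R f' z e)"
    by (intro set_integral_lebesgue_compact_support[OF C, symmetric] continuous_on_subset[OF cont2 C(2)])
      (simp add: \<phi>0)
  also have "integral\<^sup>L lborel (\<lambda>z. \<phi>' z e *\<^sub>R f z) = set_lebesgue_integral lebesgue U (\<lambda>z. \<phi>' z e *\<^sub>R f z)"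
    by (intro set_integral_lebesgue_compact_support[OF C, symmetric] continuous_on_subset[OF cont1 C(2)])
      (simp add: \<phi>'0)
  finally show "set_lebesgue_integral lebesgue U (\<lambda>z. frechet_derivative \<phi> (at z) e *\<^sub>R f z) =
      - set_lebesgue_integral lebesgue U (\<lambda>z. \<phi> z *\<^sub>R f' z e)"
    by (simp add: \<phi>'_def add_eq_0_iff)
qed

lemma L2_loc_of_continuous_on:
  assumes "open U" "continuous_on U f"
  shows "L2_loc U f"
  unfolding L2_loc_def
proof (intro conjI allI impI)
  show "f \<in> borel_measurable (lebesgue_on U)"
    using assms by (intro continuous_imp_measurable_on_sets_lebesgue) auto
  fix C assume C: "compact C \<and> C \<subseteq> U"
  have "integrable lborel (\<lambda>z. indicator C z *\<^sub>R (norm (f z))\<^sup>2)"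
    using C assms by (intro borel_integrable_compact continuous_intros) (auto intro: continuous_on_subset)
  then show "set_integrable lebesgue C (\<lambda>z. (norm (f z))\<^sup>2)"
    unfolding set_integrable_def by (subst integrable_completion) auto
qed

lemma W12_loc_of_has_derivative:
  assumes "open U" and deriv: "\<And>z. z \<in> U \<Longrightarrow> (f has_derivative f' z) (at z)"
    and cont: "\<And>e. continuous_on U (\<lambda>z. f' z e)"
  shows "W12_loc U f"
proof -
  have "continuous_on U f"
    using deriv by (meson continuous_at_imp_continuous_on has_derivative_continuous)
  then show ?thesis
    using weak_partial_of_has_derivative[OF assms(1) deriv cont] L2_loc_of_continuous_on[OF assms(1)] cont
    unfolding W12_loc_def by blast
qed

section \<open>Sharpness\<close>

text \<open>The difference d of the two points satisfies d = - k cnj d, so |d| = |k| |d|. This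
  reduces injectivity of the extremal mapping to that of its analytic part.\<close>

lemma inj_add_mult_cnj:
  assumes "\<bar>k\<bar> < 1" and "u + of_real k * cnj u = v + of_real k * cnj v"
  shows "u = v"
proof -
  have "u - v = - (of_real k * cnj (u - v))"
    using assms(2) by (simp add: algebra_simps)
  then have "norm (u - v) = \<bar>k\<bar> * norm (u - v)"
    by (metis complex_mod_cnj norm_minus_cancel norm_mult norm_of_real)
  with assms(1) show ?thesis
    by auto
qed

lemma DERIV_half_plane_map:
  fixes c z :: complex
  assumes "1 - z \<noteq> 0"
  shows "((\<lambda>z. 1 - c * ((1 + z) / (1 - z))) has_field_derivative - (2 * c) / (1 - z)\<^sup>2) (at z)"
  using assms by (auto intro!: derivative_eq_intros simp: power2_eq_square algebra_simps)

text \<open>The extremal mapping is an affine deformation of \<open>h = 1 - (1 - \<alpha>) (1 + z) / (1 - z)\<close>, which maps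
  the disk onto the half plane \<open>Re w < 1\<close> with \<open>h 0 = \<alpha>\<close>. In the limit \<open>\<alpha> \<rightarrow> 0\<close> the estimate
  \<open>\<bar>h r\<bar> \<le> \<alpha> + (\<Sum>n. \<bar>a (Suc n)\<bar> * r ^ Suc n)\<close> becomes an equality.\<close>

lemma admissible_extremal:
  assumes K: "K \<ge> 1" and \<alpha>: "0 < \<alpha>" "\<alpha> < 1" and k: "k = (K - 1) / (K + 1)"
  defines "h \<equiv> \<lambda>z. 1 - of_real (1 - \<alpha>) * ((1 + z) / (1 - z))"
  defines "g \<equiv> \<lambda>z. of_real k * (h z - of_real \<alpha>)"
  defines "a \<equiv> \<lambda>n. if n = 0 then of_real \<alpha> else of_real (- 2 * (1 - \<alpha>))"
  defines "b \<equiv> \<lambda>n::nat. of_real (- 2 * k * (1 - \<alpha>))"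
  shows "admissible K h g a b"
proof -
  let ?f = "\<lambda>z. h z + cnj (g z)"
  have k01: "0 \<le> k" "k < 1"
    using K by (auto simp: k)
  have Kk: "(1 + k) / (1 - k) = K"
    using K by (simp add: k field_simps)
  have nz: "1 - z \<noteq> 0" if "z \<in> ball 0 1" for z :: complex
    using that by auto
  define h' where "h' z = - (2 * of_real (1 - \<alpha>)) / (1 - z)\<^sup>2" for z :: complex
  have hd: "(h has_field_derivative h' z) (at z)" if "z \<in> ball 0 1" for z
    unfolding h_def h'_def by (rule DERIV_half_plane_map[OF nz[OF that]])
  have gd: "(g has_field_derivative of_real k * h' z) (at z)" if "z \<in> ball 0 1" for z
    unfolding g_def by (auto intro!: derivative_eq_intros hd[OF that])
  have fd: "(?f has_derivative (\<lambda>v. h' z * v + cnj (of_real k * h' z * v))) (at z)" if "z \<in> ball 0 1" for z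
    by (rule has_derivative_add_cnj[OF hd gd]) fact+
  have h'_nz: "h' z \<noteq> 0" if "z \<in> ball 0 1" for z
    using nz[OF that] \<alpha> by (simp add: h'_def flip: of_real_diff)
  have hol: "h holomorphic_on ball 0 1" "g holomorphic_on ball 0 1"
    unfolding holomorphic_on_open[OF open_ball] using hd gd by blast+
  have Re_le: "Re (h z) \<le> 1" if "z \<in> ball 0 1" for z
  proof -
    \<comment> \<open>This is the Poisson kernel, which is positive in the disk.\<close>
    have "Re ((1 + z) / (1 - z)) = (1 - (norm z)\<^sup>2) / (norm (1 - z))\<^sup>2"
      by (simp add: Re_divide cmod_power2) (simp add: power2_eq_square algebra_simps)
    also have "\<dots> \<ge> 0"
      using that by (simp add: abs_square_le_1)
    finally have "0 \<le> (1 - \<alpha>) * Re ((1 + z) / (1 - z))"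
      using \<alpha> by simp
    then show ?thesis
      by (simp only: h_def minus_complex.sel one_complex.sel Re_complex_of_real Im_complex_of_real
          times_complex.sel)
  qed
  \<comment> \<open>The expansion comes from (1 + z) / (1 - z) = 1 + 2 z / (1 - z).\<close>
  have tail: "(\<lambda>n. of_real (- 2 * (1 - \<alpha>)) * z ^ Suc n) sums (h z - of_real \<alpha>)" if "z \<in> ball 0 1" for z
  proof -
    have "(\<lambda>n. of_real (- 2 * (1 - \<alpha>)) * z * z ^ n) sums (of_real (- 2 * (1 - \<alpha>)) * z * (1 / (1 - z)))"
      using that by (intro sums_mult geometric_sums) auto
    also have "of_real (- 2 * (1 - \<alpha>)) * z * (1 / (1 - z)) = h z - of_real \<alpha>"
      using nz[OF that] by (simp add: h_def field_simps)
    finally show ?thesis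
      by (simp add: mult.assoc)
  qed
  have h_sums: "(\<lambda>n. a n * z ^ n) sums h z" if "z \<in> ball 0 1" for z
  proof -
    have "(\<lambda>n. a (Suc n) * z ^ Suc n) sums (h z - of_real \<alpha>)"
      using tail[OF that] by (simp add: a_def)
    then show ?thesis
      by (subst (asm) sums_Suc_iff) (simp add: a_def)
  qed
  have g_sums: "(\<lambda>n. b (Suc n) * z ^ Suc n) sums g z" if "z \<in> ball 0 1" for z
  proof -
    have "b (Suc n) = of_real k * of_real (- 2 * (1 - \<alpha>))" for n
      by (simp add: b_def algebra_simps)
    then show ?thesis
      using sums_mult[OF tail[OF that], of "of_real k"] by (simp only: g_def mult.assoc)
  qed
  have homeo: "\<exists>V f'. open V \<and> connected V \<and> homeomorphism (ball 0 1) V ?f f'"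
  proof -
    have cont: "continuous_on (ball 0 1) ?f"
      using fd by (meson continuous_at_imp_continuous_on has_derivative_continuous)
    have inj: "inj_on ?f (ball 0 1)"
    proof (rule inj_onI)
      fix z w :: complex assume z: "z \<in> ball 0 1" and w: "w \<in> ball 0 1" and eq: "?f z = ?f w"
      \<comment> \<open>The constant in \<open>g\<close> is the same at both points and
        cancels.\<close>
      have "h z + of_real k * cnj (h z) = h w + of_real k * cnj (h w)"
        using eq by (simp add: g_def algebra_simps)
      from inj_add_mult_cnj[OF _ this] have "h z = h w"
        using k01 by simp
      then have "(1 + z) / (1 - z) = (1 + w) / (1 - w)"
        using \<alpha> by (simp add: h_def del: of_real_diff times_divide_eq_right)
      then show "z = w"
        using nz[OF z] nz[OF w] by (simp add: field_simps)
    qed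
    \<comment> \<open>Invariance of domain provides the continuous inverse here and the openness of
      the image below.\<close>
    obtain f' where "homeomorphism (ball 0 1) (?f ` ball 0 1) ?f f'"
      using invariance_of_domain_homeomorphism[OF _ cont _ inj] by auto
    moreover have "open (?f ` ball 0 1)"
      by (rule invariance_of_domain[OF cont _ inj]) simp
    moreover have "connected (?f ` ball 0 1)"
      by (rule connected_continuous_image[OF cont]) simp
    ultimately show ?thesis
      by blast
  qed
  have sp: "sense_preserving_on ?f (ball 0 1)"
    unfolding sense_preserving_on_def
  proof
    fix z :: complex assume z: "z \<in> ball 0 1"
    have "k * norm (h' z) < norm (h' z)"
      using h'_nz[OF z] k01 by simp
    then have "(k * norm (h' z))\<^sup>2 < (norm (h' z))\<^sup>2"
      using k01 by (intro power_strict_mono) auto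
    then show "jacobian ?f z > 0"
      using k01 by (simp add: jacobian_def wirtinger_add_cnj[OF hd[OF z] gd[OF z]] norm_mult)
  qed
  have W12: "W12_loc (ball 0 1) ?f"
  proof (rule W12_loc_of_has_derivative[OF _ fd])
    show "continuous_on (ball 0 1) (\<lambda>z. h' z * e + cnj (of_real k * h' z * e))" for e
      unfolding h'_def using nz by (intro continuous_intros) auto
  qed auto
  have dist: "(norm (wirtinger_z ?f z) + norm (wirtinger_zbar ?f z)) /
      (norm (wirtinger_z ?f z) - norm (wirtinger_zbar ?f z)) \<le> K" if z: "z \<in> ball 0 1" for z
  proof -
    \<comment> \<open>The dilatation is the constant \<open>k\<close>, so the distortion equals K at
      every point.\<close>
    have "(norm (wirtinger_z ?f z) + norm (wirtinger_zbar ?f z)) /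
        (norm (wirtinger_z ?f z) - norm (wirtinger_zbar ?f z)) =
        ((1 + k) * norm (h' z)) / ((1 - k) * norm (h' z))"
      using k01 by (simp add: wirtinger_add_cnj[OF hd[OF z] gd[OF z]] norm_mult algebra_simps)
    also have "\<dots> = K"
      using h'_nz[OF z] Kk by simp
    finally show ?thesis
      by simp
  qed
  have "h 0 = of_real \<alpha>"
    by (simp add: h_def)
  then show ?thesis
    unfolding admissible_def quasiconformal_on_def
    using hol h_sums g_sums homeo sp W12 dist Re_le \<alpha> by auto
qed

text \<open>At the positive point r the extremal h has the value \<alpha> - (1 - \<alpha>) Q with Q
  = 2 r / (1 - r), so its modulus is at least (1 - \<alpha>) Q - \<alpha>. Adding the coefficient
  sum (1 + k) (1 - \<alpha>) Q gives (1 - \<alpha>) T - \<alpha> with T = (2 + k) Q, and T > 1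
  beyond the critical radius.\<close>

lemma bohr_radius_sharp:
  assumes K: "K \<ge> 1" and R: "R > (K + 1) / (7 * K + 3)"
  shows "\<exists>h g a b z r. admissible K h g a b \<and> norm z = r \<and> r \<le> R \<and> r < 1 \<and>
      summable (\<lambda>n. (norm (a (Suc n)) + norm (b (Suc n))) * r ^ Suc n) \<and>
      norm (h z) + (\<Sum>n. (norm (a (Suc n)) + norm (b (Suc n))) * r ^ Suc n) > 1"
proof -
  define k where "k = (K - 1) / (K + 1)"
  have k01: "0 \<le> k" "k < 1"
    using K by (auto simp: k_def)
  have "(K + 1) / (7 * K + 3) < 1"
    using K by (simp add: field_simps)
  with R have "(K + 1) / (7 * K + 3) < min R 1"
    by simp
  \<comment> \<open>The bound 1 keeps \<open>r\<close> inside the disk even if \<open>R\<close> is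
    large.\<close>
  then obtain r where r: "(K + 1) / (7 * K + 3) < r" "r < min R 1"
    using dense by blast
  have "0 < (K + 1) / (7 * K + 3)"
    using K by simp
  with r have r01: "0 < r" "r < 1" "r \<le> R"
    by auto
  define Q where "Q = 2 * (r / (1 - r))"
  define T where "T = (2 + k) * Q"
  have "T > 1"
  proof -
    have "r * (7 * K + 3) > K + 1"
      using r K by (simp add: field_simps)
    then have "(3 * K + 1) * (2 * r) > (K + 1) * (1 - r)"
      by (simp add: algebra_simps)
    moreover have "2 + k = (3 * K + 1) / (K + 1)"
      using K by (simp add: k_def field_simps)
    moreover have "(3 * K + 1) / (K + 1) * (2 * (r / (1 - r))) = (3 * K + 1) * (2 * r) / ((K + 1) * (1 - r))"
      by simp
    ultimately show ?thesis
      using r01 K by (simp add: T_def Q_def less_divide_eq_1_pos del: times_divide_eq_right times_divide_eq_left)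
  qed
  \<comment> \<open>The inequality (1 - \<alpha>) T - \<alpha> > 1 means \<alpha> < (T - 1) / (T +
    1); half of that bound is taken.\<close>
  define \<alpha> where "\<alpha> = (T - 1) / (2 * (T + 1))"
  have \<alpha>: "0 < \<alpha>" "\<alpha> < 1"
    using \<open>T > 1\<close> by (auto simp: \<alpha>_def field_simps)
  have \<alpha>T: "(1 - \<alpha>) * T - \<alpha> > 1"
  proof -
    have "\<alpha> * (T + 1) = (T - 1) / 2"
      using nonzero_eq_divide_eq[of "T + 1" \<alpha> "(T - 1) / 2"] \<open>T > 1\<close> by (simp add: \<alpha>_def)
    with \<open>T > 1\<close> show ?thesis
      by (simp add: algebra_simps)
  qed
  define h where "h = (\<lambda>z::complex. 1 - of_real (1 - \<alpha>) * ((1 + z) / (1 - z)))"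
  define g where "g = (\<lambda>z. of_real k * (h z - of_real \<alpha>))"
  define a :: "nat \<Rightarrow> complex" where "a = (\<lambda>n. if n = 0 then of_real \<alpha> else of_real (- 2 * (1 - \<alpha>)))"
  define b :: "nat \<Rightarrow> complex" where "b = (\<lambda>n. of_real (- 2 * k * (1 - \<alpha>)))"
  have adm: "admissible K h g a b"
    unfolding g_def h_def a_def b_def by (rule admissible_extremal[OF K \<alpha> k_def])
  have norms: "norm (a (Suc n)) + norm (b (Suc n)) = 2 * (1 - \<alpha>) * (1 + k)" for n
  proof -
    have "norm (a (Suc n)) = \<bar>- 2 * (1 - \<alpha>)\<bar>" "norm (b (Suc n)) = \<bar>- 2 * k * (1 - \<alpha>)\<bar>"
      unfolding a_def b_def by (simp_all only: nat.simps if_False norm_of_real)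
    then have "norm (a (Suc n)) = 2 * (1 - \<alpha>)" "norm (b (Suc n)) = 2 * k * (1 - \<alpha>)"
      using \<alpha> k01 by (simp_all add: abs_mult)
    then show ?thesis
      by (simp add: algebra_simps)
  qed
  have sums: "(\<lambda>n. (norm (a (Suc n)) + norm (b (Suc n))) * r ^ Suc n) sums
      ((1 + k) * (1 - \<alpha>) * Q)"
    using sums_mult[OF geometric_sums[of r], of "2 * (1 - \<alpha>) * (1 + k) * r"] r01
    unfolding norms Q_def
    by (simp add: mult_ac del: distrib_left_numeral distrib_right_numeral left_diff_distrib_numeral
        right_diff_distrib_numeral)
  have "h (of_real r) = of_real (\<alpha> - (1 - \<alpha>) * Q)"
  proof -
    have "h (of_real r) = of_real (1 - (1 - \<alpha>) * ((1 + r) / (1 - r)))"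
      by (simp add: h_def)
    also have "1 - (1 - \<alpha>) * ((1 + r) / (1 - r)) = \<alpha> - (1 - \<alpha>) * Q"
      using r01 by (simp add: Q_def field_simps)
    finally show ?thesis .
  qed
  then have "norm (h (of_real r)) = \<bar>\<alpha> - (1 - \<alpha>) * Q\<bar>"
    by (simp only: norm_of_real)
  then have "norm (h (of_real r)) + (1 + k) * (1 - \<alpha>) * Q \<ge> (1 - \<alpha>) * T - \<alpha>"
    using abs_ge_minus_self[of "\<alpha> - (1 - \<alpha>) * Q"]
    unfolding T_def by (simp add: algebra_simps)
  with \<alpha>T have "norm (h (of_real r)) + (\<Sum>n. (norm (a (Suc n)) + norm (b (Suc n))) * r ^ Suc n) > 1"
    using sums by (simp add: sums_iff)
  moreover have "summable (\<lambda>n. (norm (a (Suc n)) + norm (b (Suc n))) * r ^ Suc n)"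
    using sums by (simp add: sums_iff)
  moreover have "norm (of_real r :: complex) = r"
    using r01 by simp
  moreover note adm r01(2,3)
  ultimately show ?thesis
    by - (rule exI[where x = h], rule exI[where x = g], rule exI[where x = a], rule exI[where x = b],
      rule exI[where x = "of_real r"], rule exI[where x = r], intro conjI)
qed

theorem theorem3p4:
  fixes K :: real
  assumes "K \<ge> 1"
  shows "(\<forall>h g a b z r. admissible K h g a b \<and> norm z = r \<and> r \<le> (K + 1) / (7 * K + 3) \<longrightarrow>
            summable (\<lambda>n. (norm (a (Suc n)) + norm (b (Suc n))) * r ^ Suc n) \<and>
            norm (h z) + (\<Sum>n. (norm (a (Suc n)) + norm (b (Suc n))) * r ^ Suc n) \<le> 1)
       \<and> (\<forall>R. R > (K + 1) / (7 * K + 3) \<longrightarrow>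
            (\<exists>h g a b z r. admissible K h g a b \<and> norm z = r \<and> r \<le> R \<and> r < 1 \<and>
               summable (\<lambda>n. (norm (a (Suc n)) + norm (b (Suc n))) * r ^ Suc n) \<and>
               norm (h z) + (\<Sum>n. (norm (a (Suc n)) + norm (b (Suc n))) * r ^ Suc n) > 1))"
proof (intro conjI allI impI)
  fix h g a b and z :: complex and r :: real
  assume "admissible K h g a b \<and> norm z = r \<and> r \<le> (K + 1) / (7 * K + 3)"
  then have adm: "admissible K h g a b" and r: "norm z = r" "r \<le> (K + 1) / (7 * K + 3)"
    by simp_all
  show "summable (\<lambda>n. (norm (a (Suc n)) + norm (b (Suc n))) * r ^ Suc n)"
    by (rule bohr_sum_admissible(1)[OF adm assms r])
  show "norm (h z) + (\<Sum>n. (norm (a (Suc n)) + norm (b (Suc n))) * r ^ Suc n) \<le> 1"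
    by (rule bohr_sum_admissible(2)[OF adm assms r])
next
  fix R assume "R > (K + 1) / (7 * K + 3)"
  then show "\<exists>h g a b z r. admissible K h g a b \<and> norm z = r \<and> r \<le> R \<and> r < 1 \<and>
      summable (\<lambda>n. (norm (a (Suc n)) + norm (b (Suc n))) * r ^ Suc n) \<and>
      norm (h z) + (\<Sum>n. (norm (a (Suc n)) + norm (b (Suc n))) * r ^ Suc n) > 1"
    by (rule bohr_radius_sharp[OF assms])
qed

end
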